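(* Let $X$ be a multigraph with maximum valency $d>2$, and let $D$ be the chromatic index of the complete generalized truncation of $X$. Then for every integer $k$ with $3\leq k\leq D$ there is a cohesive generalized truncation of $X$ with chromatic index $k$.
   Context: A multigraph may have multiple edges but no loops; it is assumed to have no isolated vertices. Generalized truncation of $X$: take a matching $M_0$ with $|M_0|=|E(X)|$ (on $2|E(X)|$ new vertices) and a bijection $F:E(X)\to M_0$; for each edge $e$ of $X$ with ends $u,v$, label one end of $F(e)$ by $u$ and the other by $v$. For $v\in V(X)$, the cluster $\mathrm{cl}(v)$ is the set of vertices labelled $v$; insert an arbitrary graph $\mathrm{con}(v)$ (constituent) on $\mathrm{cl}(v)$. The result is a generalized truncation of $X$; it is cohesive if every constituent is connected, and it is the complete generalized truncation if every constituent is a complete graph. The chromatic index is the minimum number of colors in a proper edge coloring. *)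

theory Defs
  imports Main
begin

record ('v, 'e) pre_multigraph =
  mverts :: "'v set"
  medges :: "'e set"
  ends :: "'e \<Rightarrow> 'v set"

text \<open>Edges are named objects, so several of them may share the same two ends. Finiteness of the
  vertex set is not required.\<close>

locale multigraph =
  fixes X :: "('v, 'e) pre_multigraph"
  assumes ends_in_verts: "e \<in> medges X \<Longrightarrow> ends X e \<subseteq> mverts X"
    and two_ends: "e \<in> medges X \<Longrightarrow> card (ends X e) = 2"
    and no_isolated_verts: "v \<in> mverts X \<Longrightarrow> \<exists>e\<in>medges X. v \<in> ends X e"

definition incident_edges :: "('v, 'e) pre_multigraph \<Rightarrow> 'v \<Rightarrow> 'e set" where
  "incident_edges X v = {e \<in> medges X. v \<in> ends X e}"

definition has_max_valency :: "('v, 'e) pre_multigraph \<Rightarrow> nat \<Rightarrow> bool" where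
  "has_max_valency X d \<longleftrightarrow>
     (\<forall>v\<in>mverts X. finite (incident_edges X v) \<and> card (incident_edges X v) \<le> d) \<and>
     (\<exists>v\<in>mverts X. card (incident_edges X v) = d)"

record 'a graph =
  gverts :: "'a set"
  gedges :: "'a set set"

definition simple_graph :: "'a graph \<Rightarrow> bool" where
  "simple_graph G \<longleftrightarrow> (\<forall>e\<in>gedges G. e \<subseteq> gverts G \<and> card e = 2)"

definition connected_graph :: "'a graph \<Rightarrow> bool" where
  "connected_graph G \<longleftrightarrow>
     (\<forall>u\<in>gverts G. \<forall>v\<in>gverts G. (u, v) \<in> {(x, y). {x, y} \<in> gedges G}\<^sup>*)"

definition complete_graph :: "'a graph \<Rightarrow> bool" where
  "complete_graph G \<longleftrightarrow> gedges G = {e. e \<subseteq> gverts G \<and> card e = 2}"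

definition proper_edge_coloring :: "'a graph \<Rightarrow> nat \<Rightarrow> ('a set \<Rightarrow> nat) \<Rightarrow> bool" where
  "proper_edge_coloring G n c \<longleftrightarrow>
     c ` gedges G \<subseteq> {..<n} \<and>
     (\<forall>e\<in>gedges G. \<forall>f\<in>gedges G. e \<noteq> f \<and> e \<inter> f \<noteq> {} \<longrightarrow> c e \<noteq> c f)"

text \<open>Meaningful for graphs of bounded valency; \<open>LEAST\<close> is unspecified if no finite colouring exists.\<close>

definition chromatic_index :: "'a graph \<Rightarrow> nat" where
  "chromatic_index G = (LEAST n. \<exists>c. proper_edge_coloring G n c)"

definition matching :: "'a set set \<Rightarrow> bool" where
  "matching M \<longleftrightarrow> (\<forall>e\<in>M. card e = 2) \<and> pairwise disjnt M"

definition cluster :: "'w set set \<Rightarrow> ('w \<Rightarrow> 'v) \<Rightarrow> 'v \<Rightarrow> 'w set" where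
  "cluster M lab v = {w \<in> \<Union>M. lab w = v}"

text \<open>\<open>M\<close> is the matching, whose vertices are all the vertices of the truncation; \<open>F\<close> is the
  bijection from the edges of \<open>X\<close> onto \<open>M\<close>; \<open>lab\<close> is the labelling by vertices of \<open>X\<close>; \<open>con v\<close> is
  the constituent inserted on the cluster of \<open>v\<close>.\<close>

definition generalized_truncation_via ::
  "('v, 'e) pre_multigraph \<Rightarrow> 'w set set \<Rightarrow> ('e \<Rightarrow> 'w set) \<Rightarrow> ('w \<Rightarrow> 'v) \<Rightarrow> ('v \<Rightarrow> 'w graph)
     \<Rightarrow> 'w graph \<Rightarrow> bool" where
  "generalized_truncation_via X M F lab con Y \<longleftrightarrow>
     matching M \<and> bij_betw F (medges X) M \<and>
     (\<forall>e\<in>medges X. bij_betw lab (F e) (ends X e)) \<and>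
     (\<forall>v\<in>mverts X. simple_graph (con v) \<and> gverts (con v) = cluster M lab v) \<and>
     Y = \<lparr>gverts = \<Union>M, gedges = M \<union> (\<Union>v\<in>mverts X. gedges (con v))\<rparr>"

definition cohesive_generalized_truncation ::
  "('v, 'e) pre_multigraph \<Rightarrow> 'w graph \<Rightarrow> bool" where
  "cohesive_generalized_truncation X Y \<longleftrightarrow>
     (\<exists>M F lab con. generalized_truncation_via X M F lab con Y \<and>
        (\<forall>v\<in>mverts X. connected_graph (con v)))"

definition complete_generalized_truncation ::
  "('v, 'e) pre_multigraph \<Rightarrow> 'w graph \<Rightarrow> bool" where
  "complete_generalized_truncation X Y \<longleftrightarrow>
     (\<exists>M F lab con. generalized_truncation_via X M F lab con Y \<and>
        (\<forall>v\<in>mverts X. complete_graph (con v)))"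

text \<open>Every multigraph has a complete generalized truncation, for instance on the incident
  (edge, vertex) pairs.\<close>

lemma complete_generalized_truncation_exists:
  fixes X :: "('v, 'e) pre_multigraph"
  assumes "multigraph X"
  shows "\<exists>Y :: ('e \<times> 'v) graph. complete_generalized_truncation X Y"
proof -
  interpret multigraph X by fact
  define F where "F e = {e} \<times> ends X e" for e :: 'e
  define M where "M = F ` medges X"
  define con where "con v = (let C = cluster M snd v in
      \<lparr>gverts = C, gedges = {e. e \<subseteq> C \<and> card e = 2}\<rparr>)" for v
  have nonempty: "ends X e \<noteq> {}" if "e \<in> medges X" for e
    using two_ends[OF that] by auto
  have "matching M"
    using two_ends by (auto simp: matching_def M_def F_def card_cartesian_product_singleton
        pairwise_def disjnt_def)
  moreover have "bij_betw F (medges X) M"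
    using nonempty by (auto simp: bij_betw_def M_def F_def inj_on_def)
  moreover have "bij_betw snd (F e) (ends X e)" for e
    by (auto simp: bij_betw_def F_def inj_on_def image_def)
  moreover have "simple_graph (con v) \<and> gverts (con v) = cluster M snd v \<and> complete_graph (con v)"
    for v
    by (simp add: con_def simple_graph_def complete_graph_def Let_def)
  ultimately show ?thesis
    unfolding complete_generalized_truncation_def generalized_truncation_via_def by blast
qed

end

theory Submission
  imports Defs
begin

text \<open>
  Colouring the matching with one extra colour extends any colouring of the constituents with
  \<open>n\<close> colours to one of the truncation with \<open>n + 1\<close> colours. For \<open>k \<le> d\<close>, insert in every cluster
  a broom: a star with \<open>k - 1\<close> leaves (fewer if the cluster is smaller) with a path hanging from
  its last leaf. It can be coloured with \<open>k - 1\<close> colours, and in a cluster of size \<open>d\<close> its centre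
  has valency \<open>k\<close> in the truncation, so the chromatic index is \<open>k\<close>. A complete graph on at most
  \<open>d\<close> vertices can be coloured with \<open>d\<close> colours, so \<open>D \<le> d + 1\<close>, and the only value of \<open>k\<close> left is
  \<open>k = D\<close>, attained by the complete generalized truncation itself.
\<close>

section \<open>Bounds on the chromatic index\<close>

text \<open>Edges through a common vertex \<open>w\<close> pairwise meet, so \<open>c\<close> is
  injective on \<open>S\<close>.\<close>

lemma proper_edge_coloring_valency_le:
  assumes "proper_edge_coloring G n c" and "S \<subseteq> gedges G" and "\<And>e. e \<in> S \<Longrightarrow> w \<in> e"
  shows "card S \<le> n"
proof -
  have "inj_on c S"
    using assms unfolding inj_on_def proper_edge_coloring_def by blast
  moreover have "c ` S \<subseteq> {..<n}"
    using assms unfolding proper_edge_coloring_def by blast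
  ultimately show ?thesis
    using card_inj_on_le[of c S "{..<n}"] by simp
qed

lemma chromatic_index_le: "proper_edge_coloring G n c \<Longrightarrow> chromatic_index G \<le> n"
  unfolding chromatic_index_def by (rule Least_le) blast

lemma chromatic_index_eqI:
  assumes "proper_edge_coloring G n c" and "\<And>m b. proper_edge_coloring G m b \<Longrightarrow> n \<le> m"
  shows "chromatic_index G = n"
  unfolding chromatic_index_def using assms by (intro Least_equality) blast+

section \<open>Complete graphs and modular sums\<close>

lemma complete_graph_connected:
  assumes "complete_graph G"
  shows "connected_graph G"
  unfolding connected_graph_def
proof (intro ballI)
  fix u v assume "u \<in> gverts G" "v \<in> gverts G"
  then have "u = v \<or> {u, v} \<in> gedges G"
    using assms by (auto simp: complete_graph_def card_insert_if)
  then show "(u, v) \<in> {(x, y). {x, y} \<in> gedges G}\<^sup>*"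
    by auto
qed

lemma mod_neq_of_close:
  fixes a b m :: nat
  assumes "a < b" and "b < a + m"
  shows "a mod m \<noteq> b mod m"
proof
  assume "a mod m = b mod m"
  then have "m dvd b - a"
    using assms mod_eq_dvd_iff_nat[of a b m] by auto
  then show False
    using assms dvd_imp_le[of m "b - a"] by auto
qed

text \<open>Number the vertices below \<open>d\<close> and colour an edge by the sum of its two
  numbers modulo \<open>d\<close>. For edges \<open>{x, y}\<close> and \<open>{x, z}\<close> the
  sums differ by a nonzero amount less than \<open>d\<close>, hence so do the residues.\<close>

lemma complete_graph_colorable:
  assumes "complete_graph G" and "finite (gverts G)" and "card (gverts G) \<le> d"
  shows "\<exists>c. proper_edge_coloring G d c"
proof -
  obtain i where i: "bij_betw i (gverts G) {..<card (gverts G)}"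
    using finite_same_card_bij[OF assms(2), of "{..<card (gverts G)}"] by auto
  have less: "i x < d" if "x \<in> gverts G" for x
    using bij_betwE[OF i] that assms(3) by fastforce
  have inj: "i x \<noteq> i y" if "x \<in> gverts G" "y \<in> gverts G" "x \<noteq> y" for x y
    using i that by (meson bij_betw_imp_inj_on inj_on_eq_iff)
  have "proper_edge_coloring G d (\<lambda>e. (\<Sum>x\<in>e. i x) mod d)"
    unfolding proper_edge_coloring_def
  proof (intro conjI ballI impI)
    show "(\<lambda>e. (\<Sum>x\<in>e. i x) mod d) ` gedges G \<subseteq> {..<d}"
    proof (clarsimp)
      \<comment> \<open>The case \<open>d = 0\<close> is not excluded; an end of \<open>e\<close>
        has a number below \<open>d\<close>, which makes \<open>d\<close> positive.\<close>
      fix e assume "e \<in> gedges G"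
      then obtain x where "x \<in> gverts G"
        using assms(1) by (auto simp: complete_graph_def card_2_iff)
      then have "0 < d" using less[of x] by simp
      then show "(\<Sum>x\<in>e. i x) mod d < d" by simp
    qed
  next
    fix e f assume e: "e \<in> gedges G" and f: "f \<in> gedges G" and ne: "e \<noteq> f \<and> e \<inter> f \<noteq> {}"
    then obtain x where x: "x \<in> e" "x \<in> f" by blast
    have split: "\<exists>y. h = {x, y} \<and> x \<noteq> y" if "h \<in> gedges G" "x \<in> h" for h
      using that assms(1) by (auto simp: complete_graph_def card_2_iff)
    obtain y where y: "e = {x, y}" "x \<noteq> y" using split[OF e x(1)] by blast
    obtain z where z: "f = {x, z}" "x \<noteq> z" using split[OF f x(2)] by blast
    have in_G: "y \<in> gverts G" "z \<in> gverts G" and "y \<noteq> z"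
      using e f y z ne assms(1) by (auto simp: complete_graph_def)
    then have "i y \<noteq> i z" "i y < d" "i z < d"
      using inj less by auto
    then have "(i x + i y) mod d \<noteq> (i x + i z) mod d"
      using mod_neq_of_close[of "i x + i y" "i x + i z" d] mod_neq_of_close[of "i x + i z" "i x + i y" d]
      by (cases "i y" "i z" rule: linorder_cases) auto
    then show "(\<Sum>x\<in>e. i x) mod d \<noteq> (\<Sum>x\<in>f. i x) mod d"
      using y z by auto
  qed
  then show ?thesis by blast
qed

section \<open>Brooms\<close>

text \<open>The tree is encoded by parents, with centre 0: each edge is named by its larger end
  \<open>j\<close>, so that edges can be counted and coloured through numbers.\<close>

definition broom_parent :: "nat \<Rightarrow> nat \<Rightarrow> nat" where
  "broom_parent m j = (if j \<le> m then 0 else j - 1)"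

lemma broom_parent_less: "0 < j \<Longrightarrow> broom_parent m j < j"
  by (auto simp: broom_parent_def)

text \<open>Meeting edges \<open>i < j\<close> satisfy \<open>j - i < m\<close>: either both join
  the centre to one of 1, ..., \<open>m\<close>, or \<open>j = i + 1\<close>. The second case is
  where \<open>m\<close> must be at least 2.\<close>

lemma broom_colors_differ:
  assumes "2 \<le> m" and "0 < i" and "i < j"
    and "broom_parent m j = i \<or> broom_parent m i = broom_parent m j"
  shows "(i - 1) mod m \<noteq> (j - 1) mod m"
  by (rule mod_neq_of_close)
    (use assms in \<open>auto simp: broom_parent_def split: if_splits\<close>)

text \<open>The colouring clause serves the upper bound on the chromatic index. The last clause
  serves the lower bound: when \<open>m < card C\<close>, all of 1, ..., \<open>m\<close> are
  present around the centre.\<close>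

lemma broom_exists:
  fixes C :: "'a set"
  assumes "finite C" and m: "2 \<le> m"
  shows "\<exists>G. simple_graph G \<and> gverts G = C \<and> connected_graph G \<and>
    (\<exists>c. proper_edge_coloring G m c) \<and>
    (m < card C \<longrightarrow> (\<exists>w\<in>C. m \<le> card {e \<in> gedges G. w \<in> e}))"
proof -
  obtain g where g: "bij_betw g {..<card C} C"
    using finite_same_card_bij[of "{..<card C}" C] assms(1) by auto
  define edge where "edge j = {g (broom_parent m j), g j}" for j
  define J where "J = {0<..<card C}"
  define G where "G = \<lparr>gverts = C, gedges = edge ` J\<rparr>"
  have g_eq: "g i = g j \<longleftrightarrow> i = j" if "i < card C" "j < card C" for i j
    using g that by (auto simp: bij_betw_def inj_on_eq_iff)
  have gC: "g i \<in> C" if "i < card C" for i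
    using g that by (auto simp: bij_betw_def)
  have parent: "broom_parent m j < j" "broom_parent m j < card C" if "j \<in> J" for j
    using that broom_parent_less[of j m] by (auto simp: J_def)
  \<comment> \<open>The index of \<open>g j\<close> exceeds those of both ends of edge
    \<open>i\<close>, so a shared vertex can only be the parent end of edge
    \<open>j\<close>.\<close>
  have meet: "broom_parent m j = i \<or> broom_parent m i = broom_parent m j"
    if "i \<in> J" "j \<in> J" "i < j" "edge i \<inter> edge j \<noteq> {}" for i j
    using that parent[of i] parent[of j] unfolding edge_def
    by (auto simp: J_def g_eq)
  have inj: "inj_on edge J"
  proof (rule linorder_inj_onI)
    fix i j assume "i < j" "i \<in> J" "j \<in> J"
    then have "g j \<notin> edge i"
      using parent[of i] by (auto simp: edge_def J_def g_eq)
    then show "edge i \<noteq> edge j" by (auto simp: edge_def)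
  qed auto
  have "simple_graph G"
    unfolding simple_graph_def
  proof
    fix e assume "e \<in> gedges G"
    then obtain j where "j \<in> J" "e = edge j" by (auto simp: G_def)
    then show "e \<subseteq> gverts G \<and> card e = 2"
      using parent[of j] by (auto simp: G_def edge_def gC g_eq J_def)
  qed
  moreover have "connected_graph G"
  proof -
    let ?R = "{(x, y). {x, y} \<in> gedges G}"
    have root: "(g 0, g j) \<in> ?R\<^sup>*" if "j < card C" for j
      using that
    proof (induction j rule: less_induct)
      case (less j)
      show ?case
      proof (cases "j = 0")
        case False
        then have j: "j \<in> J" using less.prems by (simp add: J_def)
        then have "(g (broom_parent m j), g j) \<in> ?R"
          by (auto simp: G_def edge_def)
        then show ?thesis
          using less.IH[OF parent[OF j]] by (rule rtrancl_into_rtrancl[rotated])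
      qed auto
    qed
    have "sym ?R" by (auto simp: sym_def insert_commute)
    then have "sym (?R\<^sup>*)" by (rule sym_rtrancl)
    have from_root: "(g 0, u) \<in> ?R\<^sup>*" if u: "u \<in> C" for u
    proof -
      obtain j where "j < card C" "u = g j"
        using u bij_betw_imp_surj_on[OF g] by blast
      then show ?thesis using root by simp
    qed
    show ?thesis
      unfolding connected_graph_def
    proof (intro ballI)
      fix u v assume "u \<in> gverts G" "v \<in> gverts G"
      then have "(g 0, u) \<in> ?R\<^sup>*" "(g 0, v) \<in> ?R\<^sup>*"
        using from_root by (simp_all add: G_def)
      then show "(u, v) \<in> ?R\<^sup>*"
        using symD[OF \<open>sym (?R\<^sup>*)\<close>] by (meson rtrancl_trans)
    qed
  qed
  \<comment> \<open>Injectivity of \<open>edge\<close> on \<open>J\<close> lets an edge, which is a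
    mere set, be coloured through its index.\<close>
  moreover have "proper_edge_coloring G m (\<lambda>e. (the_inv_into J edge e - 1) mod m)"
  proof -
    have "(i - 1) mod m \<noteq> (j - 1) mod m"
      if "i \<in> J" "j \<in> J" "edge i \<noteq> edge j" "edge i \<inter> edge j \<noteq> {}" for i j
    proof (cases i j rule: linorder_cases)
      case less
      then show ?thesis
        using broom_colors_differ[OF m, of i j] meet[of i j] that by (simp add: J_def)
    next
      case greater
      then show ?thesis
        using broom_colors_differ[OF m, of j i] meet[of j i] that by (simp add: J_def Int_commute)
    qed (use that in simp)
    then show ?thesis
      using m by (auto simp: proper_edge_coloring_def G_def the_inv_into_f_f[OF inj])
  qed
  moreover have "\<exists>w\<in>C. m \<le> card {e \<in> gedges G. w \<in> e}" if "m < card C"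
  proof
    show "g 0 \<in> C" using that gC by simp
    have sub: "{1..m} \<subseteq> J" using that by (auto simp: J_def)
    have "card (edge ` {1..m}) = m"
      using card_image[OF inj_on_subset[OF inj sub]] by simp
    moreover have "edge ` {1..m} \<subseteq> {e \<in> gedges G. g 0 \<in> e}"
    proof -
      have "edge ` {1..m} \<subseteq> gedges G"
        using image_mono[OF sub] by (simp add: G_def)
      moreover have "g 0 \<in> edge j" if "j \<in> {1..m}" for j
        using that by (simp add: edge_def broom_parent_def)
      ultimately show ?thesis by blast
    qed
    moreover have "finite {e \<in> gedges G. g 0 \<in> e}"
      by (simp add: G_def J_def)
    ultimately show "m \<le> card {e \<in> gedges G. g 0 \<in> e}"
      using card_mono by metis
  qed
  moreover have "gverts G = C" by (simp add: G_def)
  ultimately show ?thesis by blast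
qed

section \<open>Clusters and edges of a truncation\<close>

text \<open>Each incident edge \<open>e\<close> contributes exactly one vertex, the end of
  \<open>F e\<close> labelled \<open>v\<close>. Finiteness is stated separately because
  \<open>card\<close> is 0 on infinite sets.\<close>

lemma card_cluster:
  assumes "generalized_truncation_via X M F lab con Y"
  shows "card (cluster M lab v) = card (incident_edges X v)"
    and "finite (cluster M lab v) \<longleftrightarrow> finite (incident_edges X v)"
proof -
  have M: "matching M" and F: "bij_betw F (medges X) M"
    and lab: "\<And>e. e \<in> medges X \<Longrightarrow> bij_betw lab (F e) (ends X e)"
    using assms by (auto simp: generalized_truncation_via_def)
  define h where "h e = inv_into (F e) lab v" for e
  have h: "h e \<in> F e" "lab (h e) = v" if "e \<in> incident_edges X v" for e
    using that lab[of e] unfolding h_def incident_edges_def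
    by (auto simp: bij_betw_def inv_into_into f_inv_into_f)
  have FM: "F e \<in> M" if "e \<in> medges X" for e
    using F that by (auto simp: bij_betw_def)
  have "bij_betw h (incident_edges X v) (cluster M lab v)"
    unfolding bij_betw_def
  proof (intro conjI equalityI subsetI)
    show "inj_on h (incident_edges X v)"
    proof (rule inj_onI)
      fix e f assume ef: "e \<in> incident_edges X v" "f \<in> incident_edges X v" "h e = h f"
      then have "F e \<inter> F f \<noteq> {}" using h by (metis disjoint_iff)
      then have "F e = F f"
        using M FM ef unfolding matching_def pairwise_def disjnt_def incident_edges_def by blast
      then show "e = f"
        using F ef by (auto simp: bij_betw_def inj_on_def incident_edges_def)
    qed
  next
    fix w assume "w \<in> h ` incident_edges X v"
    then show "w \<in> cluster M lab v"
      using h FM by (auto simp: cluster_def incident_edges_def)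
  next
    fix w assume "w \<in> cluster M lab v"
    then obtain e where e: "e \<in> medges X" "w \<in> F e" "lab w = v"
      using F by (auto simp: cluster_def bij_betw_def)
    then have "h e = w" "v \<in> ends X e"
      using lab[OF e(1)] unfolding h_def by (auto simp: bij_betw_def)
    then show "w \<in> h ` incident_edges X v"
      using e by (auto simp: incident_edges_def)
  qed
  then show "card (cluster M lab v) = card (incident_edges X v)"
    and "finite (cluster M lab v) \<longleftrightarrow> finite (incident_edges X v)"
    by (auto simp: bij_betw_same_card bij_betw_finite)
qed

lemma matching_edge_labels:
  assumes "generalized_truncation_via X M F lab con Y" and "e \<in> M"
  shows "card e = 2" and "inj_on lab e"
proof -
  show "card e = 2"
    using assms by (auto simp: generalized_truncation_via_def matching_def)
  obtain x where "x \<in> medges X" "e = F x"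
    using assms by (auto simp: generalized_truncation_via_def bij_betw_def)
  then show "inj_on lab e"
    using assms by (auto simp: generalized_truncation_via_def bij_betw_def)
qed

lemma constituent_edge_labels:
  assumes "generalized_truncation_via X M F lab con Y"
    and "v \<in> mverts X" and "e \<in> gedges (con v)"
  shows "card e = 2" and "x \<in> e \<Longrightarrow> lab x = v"
proof -
  have "e \<subseteq> cluster M lab v" "card e = 2"
    using assms unfolding generalized_truncation_via_def simple_graph_def by blast+
  then show "card e = 2" and "x \<in> e \<Longrightarrow> lab x = v"
    by (auto simp: cluster_def)
qed

text \<open>The two ends of a matching edge carry different labels, those of a constituent edge the
  same one.\<close>

lemma constituent_edge_not_in_matching:
  assumes "generalized_truncation_via X M F lab con Y"
    and "v \<in> mverts X" and "e \<in> gedges (con v)"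
  shows "e \<notin> M"
proof
  assume "e \<in> M"
  obtain x y where "e = {x, y}" "x \<noteq> y"
    using constituent_edge_labels(1)[OF assms] by (auto simp: card_2_iff)
  then show False
    using matching_edge_labels(2)[OF assms(1) \<open>e \<in> M\<close>] constituent_edge_labels(2)[OF assms]
    by (auto simp: inj_on_def)
qed

section \<open>Colourings of truncations\<close>

text \<open>Clusters of different vertices are disjoint, so the constituents can be coloured
  independently; colour \<open>n\<close> is reserved for the matching.\<close>

lemma truncation_colorable:
  assumes Y: "generalized_truncation_via X M F lab con Y"
    and col: "\<And>v. v \<in> mverts X \<Longrightarrow> \<exists>c. proper_edge_coloring (con v) n c"
  shows "\<exists>c. proper_edge_coloring Y (Suc n) c"
proof -
  obtain c where c: "\<And>v. v \<in> mverts X \<Longrightarrow> proper_edge_coloring (con v) n (c v)"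
    using col by metis
  \<comment> \<open>The label of an arbitrary end of \<open>e\<close> tells which constituent
    contains it; all ends of a constituent edge agree on it.\<close>
  define b where "b e = (if e \<in> M then n else c (lab (SOME x. x \<in> e)) e)" for e
  have edges: "gedges Y = M \<union> (\<Union>v\<in>mverts X. gedges (con v))"
    using Y by (simp add: generalized_truncation_via_def)
  have b_con: "b e = c v e \<and> b e < n" if "v \<in> mverts X" "e \<in> gedges (con v)" for v e
  proof -
    have "e \<noteq> {}" using constituent_edge_labels(1)[OF Y that] by auto
    then have "(SOME x. x \<in> e) \<in> e" by (simp add: some_in_eq)
    then have "b e = c v e"
      using constituent_edge_not_in_matching[OF Y that] constituent_edge_labels(2)[OF Y that]
      by (simp add: b_def)
    then show ?thesis
      using c[OF that(1)] that(2) by (auto simp: proper_edge_coloring_def)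
  qed
  have b_M: "b e = n" if "e \<in> M" for e
    using that by (simp add: b_def)
  have "b e \<noteq> b f" if e: "e \<in> gedges Y" and f: "f \<in> gedges Y" and ne: "e \<noteq> f" "e \<inter> f \<noteq> {}" for e f
  proof -
    consider "e \<in> M" "f \<in> M"
      | v where "e \<in> M" "v \<in> mverts X" "f \<in> gedges (con v)"
      | v where "f \<in> M" "v \<in> mverts X" "e \<in> gedges (con v)"
      | u v where "u \<in> mverts X" "e \<in> gedges (con u)" "v \<in> mverts X" "f \<in> gedges (con v)"
      using e f edges by blast
    then show ?thesis
    proof cases
      case 1
      then show ?thesis
        using Y ne by (auto simp: generalized_truncation_via_def matching_def pairwise_def disjnt_def)
    next
      case (2 v)
      then show ?thesis using b_con[of v f] b_M[of e] by auto
    next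
      case (3 v)
      then show ?thesis using b_con[of v e] b_M[of f] by auto
    next
      case (4 u v)
      then have "u = v"
        using constituent_edge_labels(2)[OF Y] ne(2) by blast
      then show ?thesis
        using b_con[of v e] b_con[of v f] c[of v] 4 ne by (auto simp: proper_edge_coloring_def)
    qed
  qed
  moreover have "b ` gedges Y \<subseteq> {..<Suc n}"
    using b_con b_M by (fastforce simp: edges)
  ultimately have "proper_edge_coloring Y (Suc n) b"
    by (simp add: proper_edge_coloring_def)
  then show ?thesis by blast
qed

text \<open>The \<open>Suc\<close> counts the matching edge at \<open>w\<close>. Finiteness of the
  cluster makes the set of constituent edges at \<open>w\<close> finite, so adding that edge raises
  \<open>card\<close> by one.\<close>

lemma truncation_coloring_lower_bound:
  assumes Y: "generalized_truncation_via X M F lab con Y" and v: "v \<in> mverts X"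
    and w: "w \<in> cluster M lab v" and fin: "finite (cluster M lab v)"
    and b: "proper_edge_coloring Y n b"
  shows "Suc (card {e \<in> gedges (con v). w \<in> e}) \<le> n"
proof -
  obtain a where a: "a \<in> M" "w \<in> a"
    using w by (auto simp: cluster_def)
  define S where "S = {e \<in> gedges (con v). w \<in> e}"
  have "S \<subseteq> Pow (cluster M lab v)"
    using Y v unfolding S_def generalized_truncation_via_def simple_graph_def by blast
  then have "finite S"
    using fin finite_subset by blast
  moreover have "a \<notin> S"
    using constituent_edge_not_in_matching[OF Y v] a by (auto simp: S_def)
  moreover have "insert a S \<subseteq> gedges Y"
    using Y v a by (auto simp: S_def generalized_truncation_via_def)
  then have "card (insert a S) \<le> n"
    by (rule proper_edge_coloring_valency_le[OF b, where w = w]) (auto simp: S_def a)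
  ultimately show ?thesis by (simp add: S_def)
qed

theorem theorem7p3:
  fixes X :: "('v, 'e) pre_multigraph" and Z :: "'w graph" and d D :: nat
  assumes "multigraph X"
    and "has_max_valency X d" and "d > 2"
    and "complete_generalized_truncation X Z" and "D = chromatic_index Z"
  shows "\<forall>k::nat. 3 \<le> k \<and> k \<le> D \<longrightarrow>
           (\<exists>Y :: 'w graph. cohesive_generalized_truncation X Y \<and> chromatic_index Y = k)"
proof (intro allI impI)
  fix k :: nat
  assume k: "3 \<le> k \<and> k \<le> D"
  obtain M F lab con where Z: "generalized_truncation_via X M F lab con Z"
    and complete: "\<And>v. v \<in> mverts X \<Longrightarrow> complete_graph (con v)"
    using assms(4) unfolding complete_generalized_truncation_def by blast
  have fin: "finite (cluster M lab v)" and le_d: "card (cluster M lab v) \<le> d"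
    if "v \<in> mverts X" for v
    using assms(2) that card_cluster[OF Z, of v] by (auto simp: has_max_valency_def)
  \<comment> \<open>The cluster of a vertex of maximum valency will force the lower bound.\<close>
  obtain v0 where v0: "v0 \<in> mverts X" "card (cluster M lab v0) = d"
    using assms(2) card_cluster(1)[OF Z] by (auto simp: has_max_valency_def)
  show "\<exists>Y :: 'w graph. cohesive_generalized_truncation X Y \<and> chromatic_index Y = k"
  proof (cases "k \<le> d")
    case True
    \<comment> \<open>One of the \<open>k\<close> colours is kept for the matching. From
      \<open>3 \<le> k\<close> comes \<open>2 \<le> m\<close>, and from \<open>k \<le> d\<close>
      comes \<open>m < d\<close>, so the full star fits into the cluster of
      \<open>v0\<close>.\<close>
    define m where "m = k - 1"
    have m: "2 \<le> m" "k = Suc m" "m < d" using k True by (auto simp: m_def)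
    have "\<forall>v\<in>mverts X. \<exists>G. simple_graph G \<and> gverts G = cluster M lab v \<and> connected_graph G \<and>
        (\<exists>c. proper_edge_coloring G m c) \<and>
        (m < card (cluster M lab v) \<longrightarrow>
          (\<exists>w\<in>cluster M lab v. m \<le> card {e \<in> gedges G. w \<in> e}))"
      using broom_exists[OF fin m(1)] by blast
    then obtain br where br: "\<And>v. v \<in> mverts X \<Longrightarrow> simple_graph (br v) \<and>
        gverts (br v) = cluster M lab v \<and> connected_graph (br v) \<and>
        (\<exists>c. proper_edge_coloring (br v) m c) \<and>
        (m < card (cluster M lab v) \<longrightarrow>
          (\<exists>w\<in>cluster M lab v. m \<le> card {e \<in> gedges (br v). w \<in> e}))"
      by metis
    \<comment> \<open>Matching, bijection and labels are those of \<open>Z\<close>; only the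
      constituents change, so the vertex type stays \<open>'w\<close>.\<close>
    define Y where "Y = \<lparr>gverts = \<Union>M, gedges = M \<union> (\<Union>v\<in>mverts X. gedges (br v))\<rparr>"
    have Y: "generalized_truncation_via X M F lab br Y"
      using Z br unfolding generalized_truncation_via_def Y_def by blast
    then have "cohesive_generalized_truncation X Y"
      using br unfolding cohesive_generalized_truncation_def by blast
    moreover obtain c where "proper_edge_coloring Y k c"
      using truncation_colorable[OF Y, of m] br m(2) by blast
    moreover obtain w where "w \<in> cluster M lab v0" "m \<le> card {e \<in> gedges (br v0). w \<in> e}"
      using br[OF v0(1)] v0(2) m(3) by blast
    then have "k \<le> n" if "proper_edge_coloring Y n b" for n b
      using truncation_coloring_lower_bound[OF Y v0(1) _ fin[OF v0(1)] that] m(2) by fastforce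
    ultimately show ?thesis
      using chromatic_index_eqI by blast
  next
    case False
    have "\<exists>c. proper_edge_coloring (con v) d c" if "v \<in> mverts X" for v
    proof -
      have "gverts (con v) = cluster M lab v"
        using Z that by (simp add: generalized_truncation_via_def)
      then show ?thesis
        using complete_graph_colorable[OF complete[OF that]] fin[OF that] le_d[OF that] by simp
    qed
    then obtain c where "proper_edge_coloring Z (Suc d) c"
      using truncation_colorable[OF Z] by blast
    \<comment> \<open>The bound \<open>D \<le> Suc d\<close> together with \<open>d < k\<close> and
      \<open>k \<le> D\<close> leaves only \<open>k = D\<close>.\<close>
    then have "chromatic_index Z = k"
      using chromatic_index_le False k assms(5) by fastforce
    moreover have "cohesive_generalized_truncation X Z"
      using Z complete complete_graph_connected
      unfolding cohesive_generalized_truncation_def by blast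
    ultimately show ?thesis by blast
  qed
qed

end
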